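(* For every $\theta\in\mathbb R^{|S||A|}$ with $\theta\ge0$ (entrywise), $$\big|r^\top(\theta-\theta_{\pi_\theta})\big|\le\frac{\|M\theta-(1-\gamma)\mu_0\|_1}{1-\gamma},$$ where $\theta_{\pi_\theta}=\theta_{\pi_\theta,\mu_0}$ is the discounted occupancy measure, started from $\mu_0$, of the policy $\pi_\theta$ induced by $\theta$.
   Context: $S,A$ are finite sets, $r:S\times A\to[0,1]$ a reward (viewed as a vector in $[0,1]^{|S||A|}$), $P_{s,a}\in\Delta(S)$ transition probabilities, $\gamma\in[0,1)$, $\mu_0\in\Delta(S)$. For a policy $\pi:S\to\Delta(A)$, $\theta_{\pi,\mu_0}(s,a)=(1-\gamma)\sum_{t\ge0}\gamma^t\,\mathbb P_\pi(s_t=s,a_t=a;\,s_0\sim\mu_0)$. The matrix $M\in\mathbb R^{|S|\times|S||A|}$ acts by $(M\theta)(s)=\sum_a\theta(s,a)-\gamma\sum_{\bar s,a}P_{\bar s,a}(s)\theta(\bar s,a)$. For $\theta\ge0$, $\pi_\theta(a\mid s)=\theta(s,a)/\sum_{a'}\theta(s,a')$ if $\sum_{a'}\theta(s,a')>0$, and $\pi_\theta(a\mid s)=1/|A|$ otherwise. *)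

theory Defs
  imports "HOL-Analysis.Analysis" "HOL-Probability.Probability"
begin

text \<open>
  The finite nonempty sets of states and actions are the types \<open>'s\<close> and \<open>'a\<close> of class
  \<open>finite\<close>. The simplices over them are the types \<open>'s pmf\<close> and \<open>'a pmf\<close>, and vectors indexed
  by state-action pairs have type \<open>real ^ ('s \<times> 'a)\<close>.
\<close>

definition l1_norm :: "real ^ 'n::finite \<Rightarrow> real" where
  "l1_norm x = (\<Sum>i\<in>UNIV. \<bar>x $ i\<bar>)"

definition pmf_vec :: "'s::finite pmf \<Rightarrow> real ^ 's" where
  "pmf_vec p = (\<chi> s. pmf p s)"

text \<open>
  Law of the trajectory \<open>[(s\<^sub>0, a\<^sub>0), \<dots>, (s\<^sub>t, a\<^sub>t)]\<close> under the policy \<open>\<pi>\<close> with \<open>s\<^sub>0\<close> drawn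
  from \<open>\<mu>\<close>. Events about time \<open>t\<close> depend only on this finite part of the infinite trajectory.
\<close>

primrec trajectory ::
  "('s \<Rightarrow> 'a \<Rightarrow> 's pmf) \<Rightarrow> 's pmf \<Rightarrow> ('s \<Rightarrow> 'a pmf) \<Rightarrow> nat \<Rightarrow> ('s \<times> 'a) list pmf" where
  "trajectory P \<mu> \<pi> 0 =
     bind_pmf \<mu> (\<lambda>s. bind_pmf (\<pi> s) (\<lambda>a. return_pmf [(s, a)]))"
| "trajectory P \<mu> \<pi> (Suc t) =
     bind_pmf (trajectory P \<mu> \<pi> t) (\<lambda>h. case last h of (s, a) \<Rightarrow>
       bind_pmf (P s a) (\<lambda>s'. bind_pmf (\<pi> s') (\<lambda>a'. return_pmf (h @ [(s', a')]))))"

lemma length_trajectory: "h \<in> set_pmf (trajectory P \<mu> \<pi> t) \<Longrightarrow> length h = Suc t"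
  by (induction t arbitrary: h) (auto simp: case_prod_unfold)

definition occupancy ::
  "('s::finite \<Rightarrow> 'a::finite \<Rightarrow> 's pmf) \<Rightarrow> real \<Rightarrow> 's pmf \<Rightarrow> ('s \<Rightarrow> 'a pmf) \<Rightarrow> real ^ ('s \<times> 'a)" where
  "occupancy P \<gamma> \<mu> \<pi> =
     (\<chi> x. (1 - \<gamma>) * (\<Sum>t. \<gamma> ^ t * measure_pmf.prob (trajectory P \<mu> \<pi> t) {h. h ! t = x}))"

definition flow_matrix ::
  "('s::finite \<Rightarrow> 'a::finite \<Rightarrow> 's pmf) \<Rightarrow> real \<Rightarrow> real ^ ('s \<times> 'a) ^ 's" where
  "flow_matrix P \<gamma> =
     (\<chi> s x. (if fst x = s then 1 else 0) - \<gamma> * pmf (P (fst x) (snd x)) s)"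

lemma flow_matrix_apply:
  "(flow_matrix P \<gamma> *v \<theta>) $ s =
     (\<Sum>a\<in>UNIV. \<theta> $ (s, a)) - \<gamma> * (\<Sum>s'\<in>UNIV. \<Sum>a\<in>UNIV. pmf (P s' a) s * \<theta> $ (s', a))"
proof -
  have "(flow_matrix P \<gamma> *v \<theta>) $ s =
    (\<Sum>x\<in>UNIV \<times> UNIV. (if fst x = s then \<theta> $ x else 0) - \<gamma> * (pmf (P (fst x) (snd x)) s * \<theta> $ x))"
    unfolding flow_matrix_def matrix_vector_mult_def UNIV_Times_UNIV
    by (auto intro!: sum.cong simp: algebra_simps)
  also have "\<dots> = (\<Sum>s'\<in>UNIV. \<Sum>a\<in>UNIV. if s' = s then \<theta> $ (s', a) else 0)
      - \<gamma> * (\<Sum>s'\<in>UNIV. \<Sum>a\<in>UNIV. pmf (P s' a) s * \<theta> $ (s', a))"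
    by (simp only: sum_subtractf sum_distrib_left sum.cartesian_product case_prod_unfold prod.collapse)
  also have "(\<Sum>s'\<in>UNIV. \<Sum>a\<in>UNIV. if s' = s then \<theta> $ (s', a) else 0)
      = (\<Sum>s'\<in>UNIV. if s' = s then (\<Sum>a\<in>UNIV. \<theta> $ (s', a)) else 0)"
    by (intro sum.cong) auto
  finally show ?thesis by simp
qed

definition induced_prob :: "real ^ ('s::finite \<times> 'a::finite) \<Rightarrow> 's \<Rightarrow> 'a \<Rightarrow> real" where
  "induced_prob \<theta> s a =
     (if (\<Sum>a'\<in>UNIV. \<theta> $ (s, a')) > 0
      then \<theta> $ (s, a) / (\<Sum>a'\<in>UNIV. \<theta> $ (s, a'))
      else 1 / real CARD('a))"

text \<open>Meaningful for entrywise nonnegative \<open>\<theta>\<close> only; see \<open>pmf_induced_policy\<close>.\<close>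

definition induced_policy :: "real ^ ('s::finite \<times> 'a::finite) \<Rightarrow> 's \<Rightarrow> 'a pmf" where
  "induced_policy \<theta> s = embed_pmf (induced_prob \<theta> s)"

lemma pmf_induced_policy:
  fixes \<theta> :: "real ^ ('s::finite \<times> 'a::finite)"
  assumes "\<And>x. 0 \<le> \<theta> $ x"
  shows "pmf (induced_policy \<theta> s) a = induced_prob \<theta> s a"
proof -
  have nonneg: "0 \<le> induced_prob \<theta> s a" for a
    using assms by (simp add: induced_prob_def)
  have "(\<Sum>a\<in>UNIV. induced_prob \<theta> s a) = 1"
    by (cases "(\<Sum>a'\<in>UNIV. \<theta> $ (s, a')) > 0")
      (simp_all add: induced_prob_def flip: sum_divide_distrib)
  then have "(\<integral>\<^sup>+a. ennreal (induced_prob \<theta> s a) \<partial>count_space UNIV) = 1"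
    using nonneg by (simp add: nn_integral_count_space_finite sum_ennreal)
  then show ?thesis
    unfolding induced_policy_def by (intro pmf_embed_pmf nonneg)
qed

end

theory Submission
  imports Defs
begin

text \<open>
  Both \<open>\<theta>\<close> and the occupancy measure of \<open>\<pi>\<^sub>\<theta>\<close> factor as a state marginal times \<open>\<pi>\<^sub>\<theta>\<close>, so the
  \<open>l\<^sub>1\<close> norm of their difference \<open>\<delta>\<close> equals that of its state marginal. The occupancy measure solves
  the flow equation exactly, hence the marginal of \<open>\<delta>\<close> is the residual of \<open>\<theta>\<close> plus \<open>\<gamma>\<close> times the image
  of \<open>\<delta>\<close> under a stochastic matrix, which does not increase the \<open>l\<^sub>1\<close> norm. Therefore
  \<open>(1 - \<gamma>) \<parallel>\<delta>\<parallel>\<^sub>1\<close> is at most the norm of the residual.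
\<close>

lemma pmf_bind_finite:
  fixes p :: "'x::finite pmf"
  shows "pmf (bind_pmf p f) y = (\<Sum>x\<in>UNIV. pmf p x * pmf (f x) y)"
  by (simp add: pmf_bind integral_measure_pmf[where A = UNIV])

lemma pmf_state_action:
  fixes \<nu> :: "'s::finite pmf" and \<pi> :: "'s \<Rightarrow> 'a::finite pmf"
  shows "pmf (bind_pmf \<nu> (\<lambda>s. bind_pmf (\<pi> s) (\<lambda>a. return_pmf (s, a)))) (s, a) =
    pmf \<nu> s * pmf (\<pi> s) a"
proof -
  have *: "pmf (bind_pmf (\<pi> s') (\<lambda>a'. return_pmf (s', a'))) (s, a) =
      (if s' = s then pmf (\<pi> s) a else 0)" for s'
    by (cases "s' = s") (simp_all add: pmf_bind_finite indicator_def if_distrib cong: if_cong)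
  show ?thesis
    by (simp add: pmf_bind_finite[of \<nu>] * if_distrib cong: if_cong)
qed

text \<open>The next step depends on the history only through its last pair, so these marginals
  satisfy a recursion of their own. Drawing the state first and the action from \<open>\<pi>\<close>
  afterwards gives the shape evaluated by \<open>pmf_state_action\<close>.\<close>

lemma bind_trajectory_last:
  "map_pmf last (trajectory P \<mu> \<pi> (Suc t)) =
     bind_pmf (bind_pmf (map_pmf last (trajectory P \<mu> \<pi> t)) (\<lambda>x. P (fst x) (snd x)))
       (\<lambda>s. bind_pmf (\<pi> s) (\<lambda>a. return_pmf (s, a)))"
  by (simp add: map_bind_pmf bind_map_pmf bind_assoc_pmf case_prod_unfold)

lemma prob_trajectory_nth:
  "measure_pmf.prob (trajectory P \<mu> \<pi> t) {h. h ! t = x} = pmf (map_pmf last (trajectory P \<mu> \<pi> t)) x"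
proof -
  have "map_pmf last (trajectory P \<mu> \<pi> t) = map_pmf (\<lambda>h. h ! t) (trajectory P \<mu> \<pi> t)"
  proof (rule map_pmf_cong[OF refl])
    fix h assume "h \<in> set_pmf (trajectory P \<mu> \<pi> t)"
    then have "length h = Suc t" by (rule length_trajectory)
    then show "last h = h ! t" by (subst last_conv_nth) auto
  qed
  then show ?thesis by (simp add: pmf_map vimage_def)
qed

text \<open>Split off the term at time 0 of the discounted series; each later marginal is one
  transition of its predecessor. Keeping the factor \<open>pmf (\<pi> s) a\<close> outside lets one
  identity yield both the flow equation and the factorization through \<open>\<pi>\<close>.\<close>

lemma occupancy_Bellman_flow:
  fixes P :: "'s::finite \<Rightarrow> 'a::finite \<Rightarrow> 's pmf"
  assumes "0 \<le> \<gamma>" "\<gamma> < 1"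
  shows "occupancy P \<gamma> \<mu> \<pi> $ (s, a) =
    ((1 - \<gamma>) * pmf \<mu> s + \<gamma> * (\<Sum>x\<in>UNIV. pmf (P (fst x) (snd x)) s * occupancy P \<gamma> \<mu> \<pi> $ x))
      * pmf (\<pi> s) a"
proof -
  define q where "q t = pmf (map_pmf last (trajectory P \<mu> \<pi> t))" for t
  have occ: "occupancy P \<gamma> \<mu> \<pi> $ x = (1 - \<gamma>) * (\<Sum>t. \<gamma> ^ t * q t x)" for x
    by (simp add: occupancy_def prob_trajectory_nth q_def)
  have summable: "summable (\<lambda>t. \<gamma> ^ t * q t x)" for x
  proof (rule summable_comparison_test')
    show "summable (\<lambda>t. \<gamma> ^ t)" using assms by simp
    show "norm (\<gamma> ^ t * q t x) \<le> \<gamma> ^ t" for t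
      using assms by (simp add: q_def abs_mult pmf_le_1 mult_left_le)
  qed
  have q_0: "q 0 (s, a) = pmf \<mu> s * pmf (\<pi> s) a"
    by (simp add: q_def map_bind_pmf pmf_state_action)
  have q_Suc: "q (Suc t) (s, a) = (\<Sum>x\<in>UNIV. q t x * pmf (P (fst x) (snd x)) s) * pmf (\<pi> s) a" for t
    unfolding q_def bind_trajectory_last pmf_state_action by (subst pmf_bind_finite) simp
  have "(\<Sum>t. \<gamma> ^ t * q t (s, a)) = q 0 (s, a) + (\<Sum>t. \<gamma> ^ Suc t * q (Suc t) (s, a))"
    using suminf_split_head[OF summable[of "(s, a)"]] by simp
  also have "(\<lambda>t. \<gamma> ^ Suc t * q (Suc t) (s, a)) =
      (\<lambda>t. \<Sum>x\<in>UNIV. \<gamma> * pmf (P (fst x) (snd x)) s * pmf (\<pi> s) a * (\<gamma> ^ t * q t x))"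
    by (simp add: q_Suc sum_distrib_left sum_distrib_right mult_ac)
  \<comment> \<open>Series and finite sum are interchanged, each series being dominated by the
    geometric one.\<close>
  also have "(\<Sum>t. \<Sum>x\<in>UNIV. \<gamma> * pmf (P (fst x) (snd x)) s * pmf (\<pi> s) a * (\<gamma> ^ t * q t x)) =
      (\<Sum>x\<in>UNIV. \<gamma> * pmf (P (fst x) (snd x)) s * pmf (\<pi> s) a * (\<Sum>t. \<gamma> ^ t * q t x))"
    by (subst suminf_sum) (auto intro!: summable_mult summable sum.cong suminf_mult)
  finally show ?thesis
    by (simp add: occ q_0 sum_distrib_left sum_distrib_right algebra_simps)
qed

lemma sum_pmf_finite: "(\<Sum>x\<in>UNIV. pmf (p :: 'x::finite pmf) x) = 1"
  by (rule sum_pmf_eq_1) auto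

lemma sum_state_action:
  "(\<Sum>x\<in>UNIV. f x) = (\<Sum>s\<in>UNIV. \<Sum>a\<in>UNIV. f (s :: 's::finite, a :: 'a::finite))"
  by (simp add: sum.cartesian_product flip: UNIV_Times_UNIV)

lemma flow_matrix_apply':
  "(flow_matrix P \<gamma> *v \<theta>) $ s =
     (\<Sum>a\<in>UNIV. \<theta> $ (s, a)) - \<gamma> * (\<Sum>x\<in>UNIV. pmf (P (fst x) (snd x)) s * \<theta> $ x)"
  unfolding flow_matrix_apply sum_state_action by simp

lemma flow_matrix_occupancy:
  fixes P :: "'s::finite \<Rightarrow> 'a::finite \<Rightarrow> 's pmf"
  assumes "0 \<le> \<gamma>" "\<gamma> < 1"
  shows "flow_matrix P \<gamma> *v occupancy P \<gamma> \<mu> \<pi> = (1 - \<gamma>) *\<^sub>R pmf_vec \<mu>"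
proof -
  have "(\<Sum>a\<in>UNIV. occupancy P \<gamma> \<mu> \<pi> $ (s, a)) = (1 - \<gamma>) * pmf \<mu> s +
      \<gamma> * (\<Sum>x\<in>UNIV. pmf (P (fst x) (snd x)) s * occupancy P \<gamma> \<mu> \<pi> $ x)" for s
    by (subst occupancy_Bellman_flow[OF assms]) (simp add: sum_pmf_finite flip: sum_distrib_left)
  then show ?thesis
    by (simp add: vec_eq_iff flow_matrix_apply' pmf_vec_def)
qed

text \<open>The bracket in \<open>occupancy_Bellman_flow\<close> is free of \<open>a\<close>, so
  summing over actions identifies it as the state marginal.\<close>

lemma occupancy_factor:
  fixes P :: "'s::finite \<Rightarrow> 'a::finite \<Rightarrow> 's pmf"
  assumes "0 \<le> \<gamma>" "\<gamma> < 1"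
  shows "occupancy P \<gamma> \<mu> \<pi> $ (s, a) = (\<Sum>a'\<in>UNIV. occupancy P \<gamma> \<mu> \<pi> $ (s, a')) * pmf (\<pi> s) a"
  unfolding occupancy_Bellman_flow[OF assms, of P \<mu> \<pi> s]
  by (simp add: sum_pmf_finite flip: sum_distrib_left)

lemma induced_policy_factor:
  fixes \<theta> :: "real ^ ('s::finite \<times> 'a::finite)"
  assumes "\<And>x. 0 \<le> \<theta> $ x"
  shows "\<theta> $ (s, a) = (\<Sum>a'\<in>UNIV. \<theta> $ (s, a')) * pmf (induced_policy \<theta> s) a"
proof (cases "(\<Sum>a'\<in>UNIV. \<theta> $ (s, a')) > 0")
  case True
  then show ?thesis by (simp add: pmf_induced_policy[OF assms] induced_prob_def)
next
  case False
  \<comment> \<open>Nonnegative entries with sum 0 all vanish, so both sides of the claim are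
    0.\<close>
  then have "(\<Sum>a'\<in>UNIV. \<theta> $ (s, a')) = 0"
    by (meson assms sum_nonneg order_antisym_conv not_less)
  then show ?thesis
    using assms by (simp add: sum_nonneg_eq_0_iff)
qed

lemma l1_norm_flow_matrix_ge:
  fixes P :: "'s::finite \<Rightarrow> 'a::finite \<Rightarrow> 's pmf"
  assumes "0 \<le> \<gamma>"
    and factor: "\<And>s a. \<delta> $ (s, a) = (\<Sum>a'\<in>UNIV. \<delta> $ (s, a')) * pmf (\<pi> s) a"
  shows "(1 - \<gamma>) * l1_norm \<delta> \<le> l1_norm (flow_matrix P \<gamma> *v \<delta>)"
proof -
  define d where "d s = (\<Sum>a\<in>UNIV. \<delta> $ (s, a))" for s
  define K where "K s = (\<Sum>x\<in>UNIV. pmf (P (fst x) (snd x)) s * \<delta> $ x)" for s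
  \<comment> \<open>Although \<open>\<delta>\<close> may be signed, for fixed \<open>s\<close> its
    entries are nonnegative multiples of \<open>d s\<close>, so summing over actions causes no
    cancellation.\<close>
  have "l1_norm \<delta> = (\<Sum>s\<in>UNIV. \<Sum>a\<in>UNIV. \<bar>d s\<bar> * pmf (\<pi> s) a)"
    unfolding l1_norm_def sum_state_action
    by (intro sum.cong refl, subst factor) (simp add: d_def abs_mult)
  also have "\<dots> = (\<Sum>s\<in>UNIV. \<bar>d s\<bar>)"
    by (simp add: sum_pmf_finite flip: sum_distrib_left)
  also have "\<dots> \<le> (\<Sum>s\<in>UNIV. \<bar>(flow_matrix P \<gamma> *v \<delta>) $ s\<bar> + \<gamma> * \<bar>K s\<bar>)"
  proof (rule sum_mono)
    fix s
    have "d s = (flow_matrix P \<gamma> *v \<delta>) $ s + \<gamma> * K s"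
      by (simp add: flow_matrix_apply' d_def K_def)
    then show "\<bar>d s\<bar> \<le> \<bar>(flow_matrix P \<gamma> *v \<delta>) $ s\<bar> + \<gamma> * \<bar>K s\<bar>"
      using \<open>0 \<le> \<gamma>\<close> by (metis abs_triangle_ineq abs_mult abs_of_nonneg)
  qed
  also have "\<dots> = l1_norm (flow_matrix P \<gamma> *v \<delta>) + \<gamma> * (\<Sum>s\<in>UNIV. \<bar>K s\<bar>)"
    by (simp add: l1_norm_def sum.distrib sum_distrib_left)
  finally have *: "l1_norm \<delta> \<le> l1_norm (flow_matrix P \<gamma> *v \<delta>) + \<gamma> * (\<Sum>s\<in>UNIV. \<bar>K s\<bar>)" .
  have "(\<Sum>s\<in>UNIV. \<bar>K s\<bar>) \<le> (\<Sum>s\<in>UNIV. \<Sum>x\<in>UNIV. pmf (P (fst x) (snd x)) s * \<bar>\<delta> $ x\<bar>)"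
    unfolding K_def by (intro sum_mono order_trans[OF sum_abs]) (simp add: abs_mult)
  \<comment> \<open>With the sum over next states innermost, each transition law contributes total
    mass 1.\<close>
  also have "\<dots> = (\<Sum>x\<in>UNIV. \<Sum>s\<in>UNIV. pmf (P (fst x) (snd x)) s * \<bar>\<delta> $ x\<bar>)"
    by (rule sum.swap)
  also have "\<dots> = l1_norm \<delta>"
    by (simp add: l1_norm_def sum_pmf_finite flip: sum_distrib_right)
  finally have "\<gamma> * (\<Sum>s\<in>UNIV. \<bar>K s\<bar>) \<le> \<gamma> * l1_norm \<delta>"
    using \<open>0 \<le> \<gamma>\<close> by (rule mult_left_mono)
  with * show ?thesis by (simp add: algebra_simps)
qed

text \<open>Hoelder's inequality for the exponents infinity and 1.\<close>

lemma abs_inner_le_l1_norm: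
  fixes r x :: "real ^ 'n::finite"
  assumes "\<And>i. \<bar>r $ i\<bar> \<le> 1"
  shows "\<bar>r \<bullet> x\<bar> \<le> l1_norm x"
  unfolding inner_vec_def l1_norm_def
  by (intro order_trans[OF sum_abs] sum_mono) (simp add: abs_mult assms mult_left_le_one_le)

theorem lemma3:
  fixes r :: "real ^ ('s::finite \<times> 'a::finite)"
    and P :: "'s \<Rightarrow> 'a \<Rightarrow> 's pmf"
    and \<gamma> :: real
    and \<mu>\<^sub>0 :: "'s pmf"
    and \<theta> :: "real ^ ('s \<times> 'a)"
  assumes "\<And>x. 0 \<le> r $ x \<and> r $ x \<le> 1"
    and "0 \<le> \<gamma>" and "\<gamma> < 1"
    and "\<And>x. 0 \<le> \<theta> $ x"
  shows "\<bar>r \<bullet> (\<theta> - occupancy P \<gamma> \<mu>\<^sub>0 (induced_policy \<theta>))\<bar>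
    \<le> l1_norm (flow_matrix P \<gamma> *v \<theta> - (1 - \<gamma>) *\<^sub>R pmf_vec \<mu>\<^sub>0) / (1 - \<gamma>)"
proof -
  let ?\<pi> = "induced_policy \<theta>"
  define \<delta> where "\<delta> = \<theta> - occupancy P \<gamma> \<mu>\<^sub>0 ?\<pi>"
  \<comment> \<open>For a fixed policy the factorization is linear in the vector, and both terms of
    \<open>\<delta>\<close> factor through the same \<open>?\<pi>\<close>.\<close>
  have factor: "\<delta> $ (s, a) = (\<Sum>a'\<in>UNIV. \<delta> $ (s, a')) * pmf (?\<pi> s) a" for s a
    using induced_policy_factor[of \<theta> s a] occupancy_factor[of \<gamma> P \<mu>\<^sub>0 ?\<pi> s a] assms(2-4)
    by (simp add: \<delta>_def sum_subtractf left_diff_distrib)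
  have "flow_matrix P \<gamma> *v \<delta> = flow_matrix P \<gamma> *v \<theta> - (1 - \<gamma>) *\<^sub>R pmf_vec \<mu>\<^sub>0"
    by (simp add: \<delta>_def matrix_vector_mult_diff_distrib flow_matrix_occupancy assms)
  then have "l1_norm \<delta> \<le> l1_norm (flow_matrix P \<gamma> *v \<theta> - (1 - \<gamma>) *\<^sub>R pmf_vec \<mu>\<^sub>0) / (1 - \<gamma>)"
    using l1_norm_flow_matrix_ge[OF assms(2) factor, of P] assms(3)
    by (simp add: pos_le_divide_eq mult.commute)
  moreover have "\<bar>r \<bullet> \<delta>\<bar> \<le> l1_norm \<delta>"
    using assms(1) by (intro abs_inner_le_l1_norm) simp
  ultimately show ?thesis unfolding \<delta>_def by linarith
qed

end
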